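(* Consider the following two-party game. Alice and Bob share a two-qubit state $\rho$ on $\mathbb{C}^2\otimes\mathbb{C}^2$. For each $x=x_1x_2x_3\in\{0,1\}^3$, Alice applies a completely positive trace-preserving map $\Lambda_x$ to her qubit (the first tensor factor), producing $\rho_x=(\Lambda_x\otimes\mathrm{id})(\rho)$, and sends her qubit to Bob. For each $y\in\{1,2,3\}$, Bob performs a two-outcome projective measurement $\{\Pi_y^0,\Pi_y^1\}$ on the two-qubit system, with observable $B_y=\Pi_y^0-\Pi_y^1$. The success probability is $$\mathcal{S}_Q=\frac{1}{24}\sum_{y=1}^{3}\sum_{x\in\{0,1\}^3}\mathrm{Tr}\big[\rho_x\,\Pi_y^{x_y}\big],$$ whose optimal quantum value is $\mathcal{S}_Q^{opt}=\frac12+\frac{1}{\sqrt6}$. Define the operators $$M_1=-\rho_{000}-\rho_{011}+\rho_{101}+\rho_{110},\quad M_2=-\rho_{000}+\rho_{011}-\rho_{101}+\rho_{110},\quad M_3=-\rho_{000}+\rho_{011}+\rho_{101}-\rho_{110},$$ $$N_1=\rho_{001}+\rho_{010}-\rho_{100}-\rho_{111},\quad N_2=\rho_{001}-\rho_{010}+\rho_{100}-\rho_{111},\quad N_3=-\rho_{001}+\rho_{010}+\rho_{100}-\rho_{111}.$$ If $\mathcal{S}_Q=\mathcal{S}_Q^{opt}$, then: (i) the four states $\{\rho_x: x_1\oplus x_2\oplus x_3=0\}$ are mutually orthogonal and sum to $\mathbb{1}_2\otimes\mathbb{1}_2$, and likewise the four states $\{\rho_x: x_1\oplus x_2\oplus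 x_3=1\}$ are mutually orthogonal and sum to $\mathbb{1}_2\otimes\mathbb{1}_2$; (ii) for every $x\in\{0,1\}^3$, $\mathrm{Tr}[\rho_x\rho_{\bar x}]=0$, where $\bar x$ is the bitwise complement of $x$, and $\mathrm{Tr}[\rho_x\rho_{x'}]=\frac13$ for all $x,x'$ with $x_1\oplus x_2\oplus x_3\neq x'_1\oplus x'_2\oplus x'_3$ and $x'\neq\bar x$; (iii) Bob's observables satisfy $B_y=\sqrt{\tfrac{3}{8}}\,(N_y-M_y)$ for all $y\in\{1,2,3\}$.
   Context: $\oplus$ denotes addition modulo 2. The game is the "3-bit variant of prepare-measure random access code", in which Bob on input $y$ should output $x_y$. *)

theory Defs
  imports "Jordan_Normal_Form.Matrix" Complex_Main
begin

definition mtrace :: "complex mat \<Rightarrow> complex" where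
  "mtrace A = (\<Sum>i<dim_row A. A $$ (i,i))"

definition adj :: "complex mat \<Rightarrow> complex mat" where
  "adj A = mat (dim_col A) (dim_row A) (\<lambda>(i,j). cnj (A $$ (j,i)))"

definition hermitian :: "complex mat \<Rightarrow> bool" where
  "hermitian A \<longleftrightarrow> adj A = A"

definition qform :: "complex mat \<Rightarrow> complex vec \<Rightarrow> complex" where
  "qform A v = (\<Sum>i<dim_vec v. \<Sum>j<dim_vec v. cnj (v $ i) * A $$ (i,j) * v $ j)"

definition psd :: "nat \<Rightarrow> complex mat \<Rightarrow> bool" where
  "psd n A \<longleftrightarrow> A \<in> carrier_mat n n \<and> hermitian A \<and>
     (\<forall>v \<in> carrier_vec n. 0 \<le> Re (qform A v))"

definition density :: "nat \<Rightarrow> complex mat \<Rightarrow> bool" where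
  "density n \<rho> \<longleftrightarrow> psd n \<rho> \<and> mtrace \<rho> = 1"

(* (Lambda \<otimes> id_n) applied to a (2n x 2n) matrix, first tensor factor = qubit,
   index convention: basis |a> \<otimes> |c> has index a*n + c *)
definition ext_first :: "(complex mat \<Rightarrow> complex mat) \<Rightarrow> nat \<Rightarrow> complex mat \<Rightarrow> complex mat" where
  "ext_first L n X = mat (2*n) (2*n) (\<lambda>(i,j).
      L (mat 2 2 (\<lambda>(a,b). X $$ (a*n + i mod n, b*n + j mod n))) $$ (i div n, j div n))"

definition cptp_qubit :: "(complex mat \<Rightarrow> complex mat) \<Rightarrow> bool" where
  "cptp_qubit L \<longleftrightarrow>
     (\<forall>A \<in> carrier_mat 2 2. L A \<in> carrier_mat 2 2) \<and>
     (\<forall>A \<in> carrier_mat 2 2. \<forall>B \<in> carrier_mat 2 2. L (A + B) = L A + L B) \<and>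
     (\<forall>A \<in> carrier_mat 2 2. \<forall>c. L (c \<cdot>\<^sub>m A) = c \<cdot>\<^sub>m L A) \<and>
     (\<forall>A \<in> carrier_mat 2 2. mtrace (L A) = mtrace A) \<and>
     (\<forall>n>0. \<forall>X. psd (2*n) X \<longrightarrow> psd (2*n) (ext_first L n X))"

definition projector :: "nat \<Rightarrow> complex mat \<Rightarrow> bool" where
  "projector n P \<longleftrightarrow> P \<in> carrier_mat n n \<and> hermitian P \<and> P * P = P"

definition proj_meas2 :: "nat \<Rightarrow> complex mat \<Rightarrow> complex mat \<Rightarrow> bool" where
  "proj_meas2 n P0 P1 \<longleftrightarrow> projector n P0 \<and> projector n P1 \<and> P0 + P1 = 1\<^sub>m n"

(* bit strings x = x1 x2 x3 as lists; x_y = x ! (y-1) *)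
definition bits3 :: "nat list set" where
  "bits3 = {x. length x = 3 \<and> (\<forall>i<3. x ! i \<le> 1)}"

definition parity3 :: "nat list \<Rightarrow> nat" where
  "parity3 x = (x ! 0 + x ! 1 + x ! 2) mod 2"

definition compl3 :: "nat list \<Rightarrow> nat list" where
  "compl3 x = map (\<lambda>b. 1 - b) x"

definition rhox :: "(nat list \<Rightarrow> complex mat \<Rightarrow> complex mat) \<Rightarrow> complex mat \<Rightarrow> nat list \<Rightarrow> complex mat" where
  "rhox L \<rho> x = ext_first (L x) 2 \<rho>"

definition succ_prob :: "(nat list \<Rightarrow> complex mat \<Rightarrow> complex mat) \<Rightarrow> complex mat \<Rightarrow> (nat \<Rightarrow> nat \<Rightarrow> complex mat) \<Rightarrow> real" where
  "succ_prob L \<rho> Pm = (1/24) * (\<Sum>y\<in>{1,2,3::nat}. \<Sum>x\<in>bits3.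
       Re (mtrace (rhox L \<rho> x * Pm y (x ! (y - 1)))))"

definition Mop :: "(nat list \<Rightarrow> complex mat) \<Rightarrow> nat \<Rightarrow> complex mat" where
  "Mop r y = (if y = 1 then - r [0,0,0] - r [0,1,1] + r [1,0,1] + r [1,1,0]
              else if y = 2 then - r [0,0,0] + r [0,1,1] - r [1,0,1] + r [1,1,0]
              else - r [0,0,0] + r [0,1,1] + r [1,0,1] - r [1,1,0])"

definition Nop :: "(nat list \<Rightarrow> complex mat) \<Rightarrow> nat \<Rightarrow> complex mat" where
  "Nop r y = (if y = 1 then r [0,0,1] + r [0,1,0] - r [1,0,0] - r [1,1,1]
              else if y = 2 then r [0,0,1] - r [0,1,0] + r [1,0,0] - r [1,1,1]
              else - r [0,0,1] + r [0,1,0] + r [1,0,0] - r [1,1,1])"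

end

theory Submission
  imports Defs "HOL-Analysis.Convex"
begin

text \<open>For x of even parity let D_x be the difference of the states of x and of its complement, and let
  W_y = N_y - M_y, which is the sum of the (-1)^(x_y) D_x. Orthogonality of the signs gives the
  operator identity sum_y W_y^2 = 4 sum_x D_x^2 - (sum_x D_x)^2. Each D_x^2 has trace at most 2,
  so the traces of the W_y^2 sum to at most 32; expanding the squared Hilbert-Schmidt norms of
  B_y - c W_y with c = sqrt (3/8) and inserting the optimal value bounds their sum by
  3/8 * 32 - 12 = 0. Hence B_y = c W_y, all states are pure, the states of complementary strings
  are orthogonal and the D_x sum to 0. As W_y^2 = 8/3, the identity then says that all eight
  states sum to 2, so each parity class sums to 1 and consists of orthogonal projectors. The
  overlaps come from the trace of rho_x W_y^2.\<close>

subsection \<open>Positive semidefinite matrices\<close>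

lemma hermitian_iff:
  assumes "A \<in> carrier_mat n n"
  shows "hermitian A \<longleftrightarrow> (\<forall>i<n. \<forall>j<n. cnj (A $$ (i,j)) = A $$ (j,i))"
proof
  assume "hermitian A"
  then show "\<forall>i<n. \<forall>j<n. cnj (A $$ (i,j)) = A $$ (j,i)"
    using assms unfolding hermitian_def adj_def
    by (metis carrier_matD index_mat(1) case_prod_conv complex_cnj_cnj)
next
  assume "\<forall>i<n. \<forall>j<n. cnj (A $$ (i,j)) = A $$ (j,i)"
  then show "hermitian A"
    using assms unfolding hermitian_def adj_def by (intro eq_matI) auto
qed

lemma index_mult_sum:
  assumes "A \<in> carrier_mat n m" "B \<in> carrier_mat m p" "i < n" "j < p"
  shows "(A * B) $$ (i,j) = (\<Sum>k<m. A $$ (i,k) * B $$ (k,j))"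
  using assms by (auto simp: scalar_prod_def atLeast0LessThan intro!: sum.cong)

lemma mtrace_mult:
  assumes "A \<in> carrier_mat n m" "B \<in> carrier_mat m n"
  shows "mtrace (A * B) = (\<Sum>i<n. \<Sum>k<m. A $$ (i,k) * B $$ (k,i))"
proof -
  have "dim_row (A * B) = n" using assms by simp
  then show ?thesis unfolding mtrace_def using assms
    by (auto intro!: sum.cong simp: index_mult_sum[OF assms] simp del: index_mult_mat)
qed

lemma mtrace_mult_commute:
  assumes "A \<in> carrier_mat n m" "B \<in> carrier_mat m n"
  shows "mtrace (A * B) = mtrace (B * A)"
  unfolding mtrace_mult[OF assms] mtrace_mult[OF assms(2,1)]
  by (subst sum.swap) (simp add: mult.commute)

text \<open>Vectors are plain functions on indices here, so that combinations such as
  \<open>v + t w\<close> carry no dimension side conditions; \<open>qform_eq\<close> links them to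
  \<open>qform\<close>.\<close>

definition mat_app :: "nat \<Rightarrow> complex mat \<Rightarrow> (nat \<Rightarrow> complex) \<Rightarrow> nat \<Rightarrow> complex" where
  "mat_app n A v i = (\<Sum>j<n. A $$ (i,j) * v j)"

definition inner_c :: "nat \<Rightarrow> (nat \<Rightarrow> complex) \<Rightarrow> (nat \<Rightarrow> complex) \<Rightarrow> complex" where
  "inner_c n u v = (\<Sum>i<n. cnj (u i) * v i)"

lemma qform_eq: "qform A (vec n v) = inner_c n v (mat_app n A v)"
  by (auto simp: qform_def inner_c_def mat_app_def sum_distrib_left mult_ac intro!: sum.cong)

lemma psd_iff: "psd n A \<longleftrightarrow> A \<in> carrier_mat n n \<and> hermitian A
    \<and> (\<forall>v. 0 \<le> Re (inner_c n v (mat_app n A v)))"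
proof -
  have "(\<forall>v \<in> carrier_vec n. 0 \<le> Re (qform A v)) \<longleftrightarrow> (\<forall>v. 0 \<le> Re (qform A (vec n v)))"
    by (metis vec_carrier carrier_vecD eq_vecI index_vec dim_vec)
  then show ?thesis by (simp add: psd_def qform_eq)
qed

lemma psd_carrier: "psd n A \<Longrightarrow> A \<in> carrier_mat n n" and psd_hermitian: "psd n A \<Longrightarrow> hermitian A"
  by (auto simp: psd_def)

lemma inner_c_commute: "inner_c n u v = cnj (inner_c n v u)"
  by (simp add: inner_c_def mult.commute)

lemma mult_cnj_cmod: "z * cnj z = of_real ((cmod z)\<^sup>2)"
  by (rule complex_norm_square[symmetric])

lemma inner_c_self: "inner_c n u u = of_real (\<Sum>i<n. (cmod (u i))\<^sup>2)"
  unfolding inner_c_def of_real_sum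
  by (intro sum.cong refl) (metis complex_norm_square mult.commute of_real_power)

lemma inner_c_lincomb:
  "inner_c n u (\<lambda>i. v i + t * w i) = inner_c n u v + t * inner_c n u w"
  "inner_c n (\<lambda>i. v i + t * w i) u = inner_c n v u + cnj t * inner_c n w u"
  by (simp_all add: inner_c_def algebra_simps sum.distrib sum_distrib_left)

lemma mat_app_lincomb:
  "mat_app n A (\<lambda>i. v i + t * w i) = (\<lambda>i. mat_app n A v i + t * mat_app n A w i)"
  by (rule ext) (simp add: mat_app_def algebra_simps sum.distrib sum_distrib_left)

lemma inner_c_hermitian:
  assumes "A \<in> carrier_mat n n" "hermitian A"
  shows "inner_c n u (mat_app n A v) = inner_c n (mat_app n A u) v"
proof -
  have "inner_c n u (mat_app n A v) = (\<Sum>i<n. \<Sum>j<n. cnj (u i) * A $$ (i,j) * v j)"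
    by (simp add: inner_c_def mat_app_def sum_distrib_left mult.assoc)
  also have "\<dots> = (\<Sum>j<n. \<Sum>i<n. cnj (A $$ (j,i)) * cnj (u i) * v j)"
    using assms hermitian_iff by (subst sum.swap) (auto intro!: sum.cong)
  also have "\<dots> = inner_c n (mat_app n A u) v"
    by (simp add: inner_c_def mat_app_def sum_distrib_right)
  finally show ?thesis .
qed

text \<open>The nonnegative form at \<open>v + t w\<close>, expanded by Hermiticity. Later proofs
  choose w and t so that this lower bound becomes informative.\<close>

lemma psd_quadratic:
  assumes "psd n A"
  shows "0 \<le> Re (inner_c n v (mat_app n A v)) + 2 * Re (t * inner_c n (mat_app n A v) w)
           + (cmod t)\<^sup>2 * Re (inner_c n w (mat_app n A w))"
proof -
  let ?x = "\<lambda>i. v i + t * w i"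
  have A: "A \<in> carrier_mat n n" "hermitian A" using assms by (auto simp: psd_def)
  have "0 \<le> Re (inner_c n ?x (mat_app n A ?x))" using assms by (simp only: psd_iff)
  also have "inner_c n ?x (mat_app n A ?x) = inner_c n v (mat_app n A v)
     + (t * inner_c n (mat_app n A v) w + cnj (t * inner_c n (mat_app n A v) w))
     + (t * cnj t) * inner_c n w (mat_app n A w)"
    using inner_c_commute[of n w "mat_app n A v"] inner_c_hermitian[OF A, of v w]
    by (simp add: mat_app_lincomb inner_c_lincomb algebra_simps)
  also have "t * cnj t = of_real ((cmod t)\<^sup>2)" by (rule mult_cnj_cmod)
  finally show ?thesis by (simp add: algebra_simps del: of_real_power)
qed

text \<open>Along w = A v the form at \<open>v + t w\<close> is 2 t q + t^2 d with q the squared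
  norm of w. If q were positive, a suitable negative t would make it negative.\<close>

lemma psd_null:
  assumes "psd n A" "Re (inner_c n v (mat_app n A v)) = 0" "i < n"
  shows "mat_app n A v i = 0"
proof -
  let ?w = "mat_app n A v"
  define q where "q = (\<Sum>i<n. (cmod (?w i))\<^sup>2)"
  define d where "d = Re (inner_c n ?w (mat_app n A ?w))"
  have ge: "0 \<le> 2 * (t * q) + t\<^sup>2 * d" for t :: real
    using psd_quadratic[OF assms(1), of v "of_real t" ?w] assms(2)
    by (simp add: inner_c_self q_def d_def)
  have "q \<ge> 0" by (simp add: q_def sum_nonneg)
  have "d \<ge> 0" using assms(1) by (simp add: psd_iff d_def)
  have "q = 0"
  proof (cases "d = 0")
    case True then show ?thesis using ge[of "-1"] \<open>q \<ge> 0\<close> by simp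
  next
    case False
    then have "d > 0" using \<open>d \<ge> 0\<close> by simp
    \<comment> \<open>t = -q/d minimises 2 t q + t^2 d; the minimum -q^2/d is nonnegative only for q
      = 0.\<close>
    have "0 \<le> 2 * (- q / d * q) + (- q / d)\<^sup>2 * d" by (rule ge)
    also have "\<dots> = - (q\<^sup>2 / d)" using \<open>d > 0\<close> by (simp add: power2_eq_square field_simps)
    finally show ?thesis using \<open>d > 0\<close> by (simp add: divide_le_0_iff)
  qed
  then have "(cmod (?w i))\<^sup>2 = 0"
    unfolding q_def using assms(3) by (subst (asm) sum_nonneg_eq_0_iff) auto
  then show ?thesis by simp
qed

section \<open>Schur complements and decomposition into rank-one terms\<close>

lemma mat_app_unit: "k < n \<Longrightarrow> mat_app n A (\<lambda>i. of_bool (i = k)) i = A $$ (i,k)"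
  by (simp add: mat_app_def of_bool_def if_distrib[of "\<lambda>x. _ * x"] cong: if_cong)

lemma inner_c_unit: "k < n \<Longrightarrow> inner_c n (\<lambda>i. of_bool (i = k)) v = v k"
proof -
  assume "k < n"
  have "inner_c n (\<lambda>i. of_bool (i = k)) v = (\<Sum>i<n. if i = k then v i else 0)"
    unfolding inner_c_def by (intro sum.cong refl) auto
  then show ?thesis using \<open>k < n\<close> by simp
qed

lemma psd_diag:
  assumes "psd n A" "k < n"
  shows "inner_c n (\<lambda>i. of_bool (i = k)) (mat_app n A (\<lambda>i. of_bool (i = k))) = A $$ (k,k)"
    and "A $$ (k,k) = of_real (Re (A $$ (k,k)))" and "0 \<le> Re (A $$ (k,k))"
proof -
  show *: "inner_c n (\<lambda>i. of_bool (i = k)) (mat_app n A (\<lambda>i. of_bool (i = k))) = A $$ (k,k)"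
    using assms by (simp add: inner_c_unit mat_app_unit)
  have "cnj (A $$ (k,k)) = A $$ (k,k)"
    using assms hermitian_iff psd_def by blast
  then show "A $$ (k,k) = of_real (Re (A $$ (k,k)))"
    by (simp add: complex_eq_iff)
  show "0 \<le> Re (A $$ (k,k))"
    using assms(1) unfolding psd_iff * [symmetric] by blast
qed

text \<open>One step of Cholesky elimination: the subtracted rank-one matrix agrees with A on row
  and column k, so the remainder is zero there.\<close>

lemma psd_schur_complement:
  assumes "psd n A" "k < n" "A $$ (k,k) \<noteq> 0"
  shows "psd n (mat n n (\<lambda>(i,j). A $$ (i,j) - A $$ (i,k) * cnj (A $$ (j,k)) / A $$ (k,k)))" (is "psd n ?S")
proof -
  note A = psd_carrier[OF assms(1)] psd_hermitian[OF assms(1)]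
  define p where "p = Re (A $$ (k,k))"
  have p: "A $$ (k,k) = of_real p" "p > 0"
    using psd_diag[OF assms(1,2)] assms(3) by (auto simp: p_def order_less_le)
  have herm: "i < n \<Longrightarrow> j < n \<Longrightarrow> cnj (A $$ (i,j)) = A $$ (j,i)" for i j
    using A hermitian_iff by blast
  let ?e = "\<lambda>i. of_bool (i = k) :: complex"
  have "0 \<le> Re (inner_c n v (mat_app n ?S v))" for v
  proof -
    define z where "z = mat_app n A v k"
    have z: "(\<Sum>j<n. cnj (A $$ (j,k)) * v j) = z"
      unfolding z_def mat_app_def using herm assms(2) by (intro sum.cong refl) simp
    have app: "mat_app n ?S v i = mat_app n A v i - A $$ (i,k) * (z / p)" if "i < n" for i
    proof -
      have "mat_app n ?S v i = mat_app n A v i - A $$ (i,k) / p * (\<Sum>j<n. cnj (A $$ (j,k)) * v j)"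
        using that by (simp add: mat_app_def p left_diff_distrib sum_subtractf sum_distrib_left mult.assoc)
      then show ?thesis by (simp add: z)
    qed
    have "inner_c n v (mat_app n ?S v) = inner_c n v (mat_app n A v) - (\<Sum>i<n. cnj (v i) * A $$ (i,k)) * (z / p)"
      by (simp add: inner_c_def app right_diff_distrib sum_subtractf sum_distrib_right sum_divide_distrib mult.assoc)
    also have "(\<Sum>i<n. cnj (v i) * A $$ (i,k)) = cnj z"
      unfolding z[symmetric] by (simp add: mult.commute)
    finally have "inner_c n v (mat_app n ?S v) = inner_c n v (mat_app n A v) - cnj z * z / p" by simp
    moreover have "cnj z * z = of_real ((cmod z)\<^sup>2)" by (metis complex_norm_square mult.commute)
    ultimately have S: "Re (inner_c n v (mat_app n ?S v)) = Re (inner_c n v (mat_app n A v)) - (cmod z)\<^sup>2 / p"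
      by (simp del: of_real_power)
    \<comment> \<open>this t minimises the form of A at v + t e_k, and the minimum is the form of the complement at v\<close>
    define t where "t = - z / p"
    have "inner_c n (mat_app n A v) ?e = cnj z"
      using inner_c_commute[of n "mat_app n A v" ?e] assms(2) by (simp add: inner_c_unit z_def)
    then have "t * inner_c n (mat_app n A v) ?e = of_real (- (cmod z)\<^sup>2 / p)"
      by (simp add: t_def mult_cnj_cmod del: of_real_power)
    then have "Re (t * inner_c n (mat_app n A v) ?e) = - (cmod z)\<^sup>2 / p"
      by (simp only: Re_complex_of_real)
    moreover have "(cmod t)\<^sup>2 * Re (inner_c n ?e (mat_app n A ?e)) = (cmod z)\<^sup>2 / p"
      using p by (simp add: psd_diag(1)[OF assms(1,2)] t_def norm_divide power2_eq_square)
    ultimately have "0 \<le> Re (inner_c n v (mat_app n A v)) - (cmod z)\<^sup>2 / p"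
      using psd_quadratic[OF assms(1), of v t ?e] by simp
    then show ?thesis by (simp add: S)
  qed
  moreover have "hermitian ?S"
    by (subst hermitian_iff[of _ n]) (auto simp: p herm)
  ultimately show ?thesis by (simp add: psd_iff)
qed

text \<open>A is the sum of the m rank-one matrices formed from the vectors \<open>V l\<close>. They
  need be neither orthogonal nor normalised, which lets elimination replace the spectral
  theorem.\<close>

definition gram :: "nat \<Rightarrow> nat \<Rightarrow> (nat \<Rightarrow> nat \<Rightarrow> complex) \<Rightarrow> complex mat \<Rightarrow> bool" where
  "gram n m V A \<longleftrightarrow> (\<forall>i<n. \<forall>j<n. A $$ (i,j) = (\<Sum>l<m. V l i * cnj (V l j)))"

lemma psd_decomposition:
  assumes "psd n A"
  shows "\<exists>m V. gram n m V A"
proof -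
  \<comment> \<open>Generalised for the induction to matrices supported on the leading k by k block;
    for k = n the support condition is vacuous.\<close>
  have "\<exists>V. gram n k V A"
    if "k \<le> n" "psd n A" "\<forall>i<n. \<forall>j<n. i \<ge> k \<or> j \<ge> k \<longrightarrow> A $$ (i,j) = 0" for k
    using that
  proof (induction k arbitrary: A)
    case 0
    then show ?case by (simp add: gram_def)
  next
    case (Suc k)
    note A = psd_carrier[OF Suc.prems(2)] psd_hermitian[OF Suc.prems(2)]
    have herm: "i < n \<Longrightarrow> j < n \<Longrightarrow> cnj (A $$ (i,j)) = A $$ (j,i)" for i j
      using A hermitian_iff by blast
    have k: "k < n" using Suc.prems(1) by simp
    show ?case
    proof (cases "A $$ (k,k) = 0")
      case True
      \<comment> \<open>With a zero pivot the form vanishes at the k-th unit vector, so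
        \<open>psd_null\<close> kills the whole column.\<close>
      have col: "A $$ (i,k) = 0" if "i < n" for i
        using psd_null[OF Suc.prems(2) _ that, of "\<lambda>i. of_bool (i = k)"]
          psd_diag(1)[OF Suc.prems(2) k] True mat_app_unit[OF k] by simp
      then have row: "A $$ (k,i) = 0" if "i < n" for i using herm[OF that k] that by (metis complex_cnj_zero)
      have "\<forall>i<n. \<forall>j<n. i \<ge> k \<or> j \<ge> k \<longrightarrow> A $$ (i,j) = 0"
        using Suc.prems(3) row col by (metis Suc_leI le_neq_implies_less)
      from Suc.IH[OF less_imp_le[OF k] Suc.prems(2) this] obtain V
        where V: "gram n k V A"
        by blast
      have "gram n (Suc k) (V(k := \<lambda>_. 0)) A"
        using V by (simp add: gram_def)
      then show ?thesis by blast
    next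
      case False
      define p where "p = Re (A $$ (k,k))"
      have p: "A $$ (k,k) = of_real p" "p > 0"
        using psd_diag[OF Suc.prems(2) k] False by (auto simp: p_def order_less_le)
      let ?S = "mat n n (\<lambda>(i,j). A $$ (i,j) - A $$ (i,k) * cnj (A $$ (j,k)) / A $$ (k,k))"
      have "?S $$ (i,j) = 0" if "i < n" "j < n" "i \<ge> k \<or> j \<ge> k" for i j
      proof -
        \<comment> \<open>Elimination clears row and column k. Beyond k both the entry of A and the
          subtracted product already vanish.\<close>
        consider "i = k" | "j = k" | "i \<ge> Suc k" | "j \<ge> Suc k" using \<open>i \<ge> k \<or> j \<ge> k\<close> by linarith
        then show ?thesis
        proof cases
          case 1 then show ?thesis using that False herm[OF that(2) k] by simp
        next
          case 2 then show ?thesis using that p herm[OF k k] by simp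
        qed (use that Suc.prems(3) k in auto)
      qed
      then have "\<forall>i<n. \<forall>j<n. i \<ge> k \<or> j \<ge> k \<longrightarrow> ?S $$ (i,j) = 0" by blast
      from Suc.IH[OF less_imp_le[OF k] psd_schur_complement[OF Suc.prems(2) k False] this]
      obtain V
        where V: "gram n k V ?S" by blast
      \<comment> \<open>Dividing by \<open>sqrt p\<close> makes the new rank-one term exactly what
        the Schur complement subtracted.\<close>
      let ?V = "V(k := \<lambda>i. A $$ (i,k) / sqrt p)"
      have "of_real (sqrt p) * of_real (sqrt p) = (of_real p :: complex)"
        using p(2) by (simp flip: of_real_mult)
      then have "gram n (Suc k) ?V A"
        using V by (simp add: gram_def p algebra_simps)
      then show ?thesis by blast
    qed
  qed
  from this[OF order_refl assms] show ?thesis by auto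
qed

section \<open>Traces of products of positive semidefinite matrices\<close>

lemma mtrace_decomposition:
  assumes "A \<in> carrier_mat n n" "B \<in> carrier_mat n n"
    and V: "\<And>i j. i < n \<Longrightarrow> j < n \<Longrightarrow> A $$ (i,j) = (\<Sum>l<m. V l i * cnj (V l j))"
  shows "mtrace (A * B) = (\<Sum>l<m. inner_c n (V l) (mat_app n B (V l)))"
proof -
  have "mtrace (A * B) = (\<Sum>j<n. \<Sum>i<n. B $$ (j,i) * A $$ (i,j))"
    using mtrace_mult_commute[OF assms(1,2)] mtrace_mult[OF assms(2,1)] by simp
  also have "\<dots> = (\<Sum>j<n. \<Sum>i<n. \<Sum>l<m. B $$ (j,i) * (V l i * cnj (V l j)))"
    by (simp add: V sum_distrib_left)
  also have "\<dots> = (\<Sum>j<n. \<Sum>l<m. \<Sum>i<n. B $$ (j,i) * (V l i * cnj (V l j)))"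
    by (intro sum.cong refl sum.swap)
  also have "\<dots> = (\<Sum>l<m. \<Sum>j<n. \<Sum>i<n. B $$ (j,i) * (V l i * cnj (V l j)))"
    by (rule sum.swap)
  finally show ?thesis by (simp add: inner_c_def mat_app_def sum_distrib_left mult_ac)
qed

lemma mtrace_psd_mult_nonneg:
  assumes "psd n A" "psd n B"
  shows "0 \<le> Re (mtrace (A * B))"
proof -
  obtain V m where "gram n m V A"
    using psd_decomposition[OF assms(1)] by blast
  then have V: "A $$ (i,j) = (\<Sum>l<m. V l i * cnj (V l j))" if "i < n" "j < n" for i j
    using that by (simp add: gram_def)
  have "mtrace (A * B) = (\<Sum>l<m. inner_c n (V l) (mat_app n B (V l)))"
    by (rule mtrace_decomposition[OF psd_carrier[OF assms(1)] psd_carrier[OF assms(2)]]) (rule V)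
  then show ?thesis using assms(2) by (simp add: psd_iff sum_nonneg)
qed

text \<open>Equality case of \<open>mtrace_psd_mult_nonneg\<close>: the trace is a sum of values of
  the form of B at the vectors of A. All of them must vanish, so B annihilates each vector by
  \<open>psd_null\<close>.\<close>

lemma psd_mult_zero:
  assumes "psd n A" "psd n B" "Re (mtrace (A * B)) = 0"
  shows "B * A = 0\<^sub>m n n"
proof -
  note A = psd_carrier[OF assms(1)] and B = psd_carrier[OF assms(2)]
  obtain V m where "gram n m V A"
    using psd_decomposition[OF assms(1)] by blast
  then have V: "A $$ (i,j) = (\<Sum>l<m. V l i * cnj (V l j))" if "i < n" "j < n" for i j
    using that by (simp add: gram_def)
  have "mtrace (A * B) = (\<Sum>l<m. inner_c n (V l) (mat_app n B (V l)))"
    by (rule mtrace_decomposition[OF A B]) (rule V)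
  then have "(\<Sum>l<m. Re (inner_c n (V l) (mat_app n B (V l)))) = 0"
    using assms(3) by simp
  then have "\<forall>l<m. Re (inner_c n (V l) (mat_app n B (V l))) = 0"
    using assms(2) by (subst (asm) sum_nonneg_eq_0_iff) (auto simp: psd_iff)
  then have null: "l < m \<Longrightarrow> i < n \<Longrightarrow> mat_app n B (V l) i = 0" for l i
    using psd_null[OF assms(2)] by blast
  show ?thesis
  proof (rule eq_matI)
    fix i j assume "i < dim_row (0\<^sub>m n n :: complex mat)" "j < dim_col (0\<^sub>m n n :: complex mat)"
    then have ij: "i < n" "j < n" by auto
    have "(B * A) $$ (i,j) = (\<Sum>k<n. \<Sum>l<m. B $$ (i,k) * (V l k * cnj (V l j)))"
      using index_mult_sum[OF B A ij] ij by (simp add: V sum_distrib_left del: index_mult_mat)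
    also have "\<dots> = (\<Sum>l<m. mat_app n B (V l) i * cnj (V l j))"
      by (subst sum.swap) (simp add: mat_app_def sum_distrib_right mult.assoc)
    also have "\<dots> = 0" using null ij by simp
    finally show "(B * A) $$ (i,j) = 0\<^sub>m n n $$ (i,j)" using ij by simp
  qed (use A B in auto)
qed

lemma Cauchy_Schwarz_inner_c:
  "(cmod (inner_c n u v))\<^sup>2 \<le> (\<Sum>i<n. (cmod (u i))\<^sup>2) * (\<Sum>i<n. (cmod (v i))\<^sup>2)"
proof -
  have "cmod (inner_c n u v) \<le> (\<Sum>i<n. cmod (u i) * cmod (v i))"
    unfolding inner_c_def by (rule order_trans[OF norm_sum]) (simp add: norm_mult)
  then have "(cmod (inner_c n u v))\<^sup>2 \<le> (\<Sum>i<n. cmod (u i) * cmod (v i))\<^sup>2"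
    by (simp add: power_mono)
  also have "\<dots> \<le> (\<Sum>i<n. (cmod (u i))\<^sup>2) * (\<Sum>i<n. (cmod (v i))\<^sup>2)"
    by (rule Cauchy_Schwarz_ineq_sum)
  finally show ?thesis .
qed

lemma hermitian_minus:
  assumes "A \<in> carrier_mat n n" "B \<in> carrier_mat n n" "hermitian A" "hermitian B"
  shows "hermitian (A - B)"
  using assms hermitian_iff[OF assms(1)] hermitian_iff[OF assms(2)] hermitian_iff[OF minus_carrier_mat[OF assms(2)]]
  by simp

text \<open>By Cauchy-Schwarz each rank-one term contributes at most the product of the squared
  norms of \<open>V l\<close> and v, and the squared norms of the \<open>V l\<close> add up to the
  trace, which is 1.\<close>

lemma psd_one_minus:
  assumes "psd n A" "mtrace A = 1"
  shows "psd n (1\<^sub>m n - A)"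
proof -
  note A = psd_carrier[OF assms(1)]
  obtain V m where "gram n m V A"
    using psd_decomposition[OF assms(1)] by blast
  then have V: "A $$ (i,j) = (\<Sum>l<m. V l i * cnj (V l j))" if "i < n" "j < n" for i j
    using that by (simp add: gram_def)
  have herm: "hermitian (1\<^sub>m n - A)"
    using A psd_hermitian[OF assms(1)] by (intro hermitian_minus[of _ n]) (auto simp: hermitian_iff[of _ n])
  have "of_real (\<Sum>l<m. \<Sum>i<n. (cmod (V l i))\<^sup>2) = mtrace A"
  proof -
    have "mtrace A = (\<Sum>i<n. \<Sum>l<m. V l i * cnj (V l i))" using A by (simp add: mtrace_def V)
    also have "\<dots> = (\<Sum>l<m. \<Sum>i<n. V l i * cnj (V l i))" by (rule sum.swap)
    finally show ?thesis by (simp add: mult_cnj_cmod)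
  qed
  then have tr: "(\<Sum>l<m. \<Sum>i<n. (cmod (V l i))\<^sup>2) = 1"
    using assms(2) of_real_eq_1_iff by metis
  have "0 \<le> Re (inner_c n v (mat_app n (1\<^sub>m n - A) v))" for v
  proof -
    have "inner_c n v (mat_app n A v) = (\<Sum>l<m. inner_c n (V l) v * cnj (inner_c n (V l) v))"
    proof -
      have "inner_c n v (mat_app n A v) = (\<Sum>i<n. \<Sum>j<n. \<Sum>l<m. cnj (v i) * (V l i * cnj (V l j) * v j))"
        by (simp add: inner_c_def mat_app_def V sum_distrib_left sum_distrib_right)
      also have "\<dots> = (\<Sum>i<n. \<Sum>l<m. \<Sum>j<n. cnj (v i) * (V l i * cnj (V l j) * v j))"
        by (intro sum.cong refl sum.swap)
      also have "\<dots> = (\<Sum>l<m. \<Sum>i<n. \<Sum>j<n. cnj (v i) * (V l i * cnj (V l j) * v j))"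
        by (rule sum.swap)
      also have "\<dots> = (\<Sum>l<m. cnj (inner_c n (V l) v) * inner_c n (V l) v)"
        unfolding inner_c_def cnj_sum sum_product by (intro sum.cong refl) (simp add: mult_ac)
      finally show ?thesis by (simp add: mult.commute)
    qed
    then have A_form: "Re (inner_c n v (mat_app n A v)) = (\<Sum>l<m. (cmod (inner_c n (V l) v))\<^sup>2)"
      by (simp add: mult_cnj_cmod del: of_real_power)
    also have "\<dots> \<le> (\<Sum>l<m. (\<Sum>i<n. (cmod (V l i))\<^sup>2) * (\<Sum>i<n. (cmod (v i))\<^sup>2))"
      by (intro sum_mono Cauchy_Schwarz_inner_c)
    also have "\<dots> = (\<Sum>i<n. (cmod (v i))\<^sup>2)"
      by (simp add: tr flip: sum_distrib_right)
    finally have le: "Re (inner_c n v (mat_app n A v)) \<le> (\<Sum>i<n. (cmod (v i))\<^sup>2)" .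
    have "mat_app n (1\<^sub>m n - A) v i = v i - mat_app n A v i" if "i < n" for i
      using that A by (simp add: mat_app_def algebra_simps sum_subtractf if_distrib[of "\<lambda>x. _ * x"] cong: if_cong)
    then have "inner_c n v (mat_app n (1\<^sub>m n - A) v) = inner_c n v v - inner_c n v (mat_app n A v)"
      by (simp add: inner_c_def right_diff_distrib sum_subtractf)
    then show ?thesis using le by (simp add: inner_c_self)
  qed
  then show ?thesis using herm A by (simp add: psd_iff minus_carrier_mat)
qed

text \<open>Bridges the real-valued trace of the abstract argument and the complex traces of the
  theorem.\<close>

lemma mtrace_hermitian_mult:
  assumes "A \<in> carrier_mat n n" "B \<in> carrier_mat n n" "hermitian A" "hermitian B"
  shows "mtrace (A * B) = of_real (Re (mtrace (A * B)))"
proof -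
  have "cnj (mtrace (A * B)) = (\<Sum>i<n. \<Sum>k<n. A $$ (k,i) * B $$ (i,k))"
    using assms hermitian_iff[of A n] hermitian_iff[of B n]
    by (auto simp: mtrace_mult[OF assms(1,2)] intro!: sum.cong)
  also have "\<dots> = mtrace (A * B)" unfolding mtrace_mult[OF assms(1,2)] by (rule sum.swap)
  finally show ?thesis by (simp add: complex_eq_iff)
qed

text \<open>The squared Hilbert-Schmidt norm; it makes the trace form positive definite on Hermitian
  matrices.\<close>

lemma mtrace_hermitian_square:
  assumes "A \<in> carrier_mat n n" "hermitian A"
  shows "Re (mtrace (A * A)) = (\<Sum>i<n. \<Sum>k<n. (cmod (A $$ (i,k)))\<^sup>2)"
proof -
  have "mtrace (A * A) = (\<Sum>i<n. \<Sum>k<n. A $$ (i,k) * cnj (A $$ (i,k)))"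
    using assms hermitian_iff[of A n] by (auto simp: mtrace_mult[OF assms(1,1)] intro!: sum.cong)
  then show ?thesis by (simp add: mult_cnj_cmod del: of_real_power)
qed

text \<open>With indices split as \<open>a * n + c\<close>, the diagonal entries sharing c form the
  diagonal of L applied to one 2 by 2 block, whose trace L preserves.\<close>

lemma mtrace_ext_first:
  assumes "cptp_qubit L" "0 < n" "X \<in> carrier_mat (2*n) (2*n)"
  shows "mtrace (ext_first L n X) = mtrace X"
proof -
  define blk where "blk c = mat 2 2 (\<lambda>(a,b). X $$ (a*n + c, b*n + c))" for c
  have split: "(\<Sum>i<2*n. f i) = (\<Sum>c<n. \<Sum>a<2. f (a*n + c))" for f :: "nat \<Rightarrow> complex"
  proof -
    have "(\<Sum>i<n + m. f i) = (\<Sum>i<n. f i) + (\<Sum>i<m. f (n + i))" for m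
      by (induction m) (auto simp: add.assoc)
    from this[of n] have "(\<Sum>i<2*n. f i) = (\<Sum>c<n. f c) + (\<Sum>c<n. f (n + c))"
      by (simp add: mult_2)
    then show ?thesis by (simp add: numeral_2_eq_2 sum.distrib)
  qed
  have "mtrace (ext_first L n X) = (\<Sum>c<n. \<Sum>a<2. ext_first L n X $$ (a*n + c, a*n + c))"
    unfolding mtrace_def by (subst split[symmetric]) (simp add: ext_first_def)
  also have "\<dots> = (\<Sum>c<n. \<Sum>a<2. L (blk c) $$ (a,a))"
  proof (intro sum.cong refl)
    fix c a assume "c \<in> {..<n}" "a \<in> {..<2::nat}"
    moreover from this have "a*n + c < 2*n" by (auto simp: less_2_cases_iff)
    ultimately show "ext_first L n X $$ (a*n + c, a*n + c) = L (blk c) $$ (a,a)"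
      by (auto simp: ext_first_def blk_def)
  qed
  also have "\<dots> = (\<Sum>c<n. mtrace (L (blk c)))"
  proof (intro sum.cong refl)
    fix c have "L (blk c) \<in> carrier_mat 2 2" using assms(1) by (simp add: cptp_qubit_def blk_def)
    then show "(\<Sum>a<2. L (blk c) $$ (a,a)) = mtrace (L (blk c))" by (simp add: mtrace_def)
  qed
  also have "\<dots> = (\<Sum>c<n. mtrace (blk c))" using assms(1) by (simp add: cptp_qubit_def blk_def)
  also have "\<dots> = mtrace X"
    unfolding mtrace_def using assms(3) by (simp add: split blk_def)
  finally show ?thesis .
qed

subsection \<open>Optimal strategies in a tracial algebra\<close>

text \<open>H stands for the Hermitian and P for the positive semidefinite elements; tr is the real part of the trace.\<close>

locale tracial_algebra =
  fixes tr :: "'a::real_algebra_1 \<Rightarrow> real" and H P :: "'a set"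
  assumes tr_linear: "linear tr"
    and tr_commute: "tr (x * y) = tr (y * x)"
    and H_subspace: "subspace H"
    and tr_square_nonneg: "x \<in> H \<Longrightarrow> 0 \<le> tr (x * x)"
    and tr_square_zero: "x \<in> H \<Longrightarrow> tr (x * x) = 0 \<Longrightarrow> x = 0"
    and P_H: "P \<subseteq> H"
    and P_compl: "x \<in> P \<Longrightarrow> tr x = 1 \<Longrightarrow> 1 - x \<in> P"
    and tr_pos: "x \<in> P \<Longrightarrow> y \<in> P \<Longrightarrow> 0 \<le> tr (x * y)"
    and tr_pos_zero: "x \<in> P \<Longrightarrow> y \<in> P \<Longrightarrow> tr (x * y) = 0 \<Longrightarrow> x * y = 0"
begin

lemmas tr_simps = linear_add[OF tr_linear] linear_diff[OF tr_linear] linear_cmul[OF tr_linear]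
  linear_sum[OF tr_linear] linear_0[OF tr_linear]

text \<open>Since 1 - x is positive as well, tr (x (1 - x)) is nonnegative; in the equality case x
  (1 - x) = 0, which is \<open>pure_idem\<close>.\<close>

lemma purity_le: "tr (x * x) \<le> 1" if "x \<in> P" "tr x = 1"
  using tr_pos[OF that(1) P_compl[OF that]] that(2) by (simp add: algebra_simps tr_simps)

lemma pure_idem: "x * x = x" if "x \<in> P" "tr x = 1" "tr (x * x) = 1"
  using tr_pos_zero[OF that(1) P_compl[OF that(1,2)]] that by (simp add: algebra_simps tr_simps)

end

text \<open>The index set is the set of even bit strings x, where a x and b x are the states of x and of its
  complement and h y x is the sign of the bit x_y; the observables are numbered from 0.\<close>

locale optimal_strategy = tracial_algebra +
  fixes I :: "'i set" and a b :: "'i \<Rightarrow> 'a::real_algebra_1"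
    and h :: "nat \<Rightarrow> 'i \<Rightarrow> real" and B :: "nat \<Rightarrow> 'a"
  assumes tr_one: "tr 1 = 4"
    and I: "finite I" "card I = 4"
    and a: "i \<in> I \<Longrightarrow> a i \<in> P" "i \<in> I \<Longrightarrow> tr (a i) = 1"
    and b: "i \<in> I \<Longrightarrow> b i \<in> P" "i \<in> I \<Longrightarrow> tr (b i) = 1"
    and h_sq: "y < 3 \<Longrightarrow> i \<in> I \<Longrightarrow> h y i * h y i = 1"
    and h_orth: "i \<in> I \<Longrightarrow> k \<in> I \<Longrightarrow> (\<Sum>y<3. h y i * h y k) = (if i = k then 3 else -1)"
    and B: "y < 3 \<Longrightarrow> B y \<in> H" "y < 3 \<Longrightarrow> B y * B y = 1"
    and opt: "(\<Sum>y<3. tr (B y * (\<Sum>i\<in>I. h y i *\<^sub>R (a i - b i)))) = 8 * sqrt 6"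
begin

section \<open>The chain of bounds and its equality case\<close>

definition D where "D i = a i - b i"
definition W where "W y = (\<Sum>i\<in>I. h y i *\<^sub>R D i)"

lemma a_H: "i \<in> I \<Longrightarrow> a i \<in> H" and b_H: "i \<in> I \<Longrightarrow> b i \<in> H"
  using a b P_H by auto

lemma D_H: "i \<in> I \<Longrightarrow> D i \<in> H"
  unfolding D_def by (intro subspace_diff[OF H_subspace] a_H b_H)

lemma sum_D_H: "(\<Sum>i\<in>I. D i) \<in> H"
  by (intro subspace_sum[OF H_subspace] D_H)

lemma W_H: "W y \<in> H"
  unfolding W_def by (intro subspace_sum[OF H_subspace] subspace_scale[OF H_subspace] D_H)

text \<open>Summing over y first leaves, by \<open>h_orth\<close>, the coefficient 3 on the diagonal
  and -1 off it. Written as 4 - 1 and 0 - 1, the -1 part reassembles into the square of the plain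
  sum.\<close>

lemma sum_W_square: "(\<Sum>y<3. W y * W y) = 4 *\<^sub>R (\<Sum>i\<in>I. D i * D i) - (\<Sum>i\<in>I. D i) * (\<Sum>i\<in>I. D i)"
proof -
  have "(\<Sum>y<3. W y * W y) = (\<Sum>y<3. \<Sum>i\<in>I. \<Sum>k\<in>I. (h y i * h y k) *\<^sub>R (D i * D k))"
    by (simp add: W_def sum_product mult.commute)
  also have "\<dots> = (\<Sum>i\<in>I. \<Sum>y<3. \<Sum>k\<in>I. (h y i * h y k) *\<^sub>R (D i * D k))"
    by (rule sum.swap)
  also have "\<dots> = (\<Sum>i\<in>I. \<Sum>k\<in>I. (\<Sum>y<3. h y i * h y k) *\<^sub>R (D i * D k))"
    unfolding scaleR_sum_left by (intro sum.cong refl sum.swap)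
  also have "\<dots> = (\<Sum>i\<in>I. \<Sum>k\<in>I. (if i = k then 4 *\<^sub>R (D i * D k) else 0) - D i * D k)"
    using scaleR_left_diff_distrib[of 4 1] by (intro sum.cong refl) (auto simp: h_orth)
  also have "\<dots> = (\<Sum>i\<in>I. 4 *\<^sub>R (D i * D i)) - (\<Sum>i\<in>I. \<Sum>k\<in>I. D i * D k)"
    by (simp add: sum_subtractf I)
  finally show ?thesis by (simp add: sum_product scaleR_sum_right)
qed

lemma tr_D_square: "tr (D i * D i) = tr (a i * a i) + tr (b i * b i) - 2 * tr (a i * b i)"
  using tr_commute[of "a i" "b i"] by (simp add: D_def algebra_simps tr_simps)

lemma tr_D_square_le: "i \<in> I \<Longrightarrow> tr (D i * D i) \<le> 2"
  using purity_le[of "a i"] purity_le[of "b i"] tr_pos[of "a i" "b i"] a b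
  by (simp add: tr_D_square)

lemma sum_tr_W_square:
  "(\<Sum>y<3. tr (W y * W y)) = 4 * (\<Sum>i\<in>I. tr (D i * D i)) - tr ((\<Sum>i\<in>I. D i) * (\<Sum>i\<in>I. D i))"
  using arg_cong[OF sum_W_square, of tr] by (simp add: tr_simps)

lemma sum_tr_D_square_le: "(\<Sum>i\<in>I. tr (D i * D i)) \<le> 8"
  using sum_mono[of I "\<lambda>i. tr (D i * D i)" "\<lambda>_. 2", OF tr_D_square_le] I by simp

text \<open>If all bounds are attained, the \<open>W y\<close> have squared norms summing to 32 and
  the \<open>B y\<close> to 12, so proportionality requires c^2 = 12/32.\<close>

definition c :: real where "c = sqrt (3/8)"

lemma c_props: "c * c = 3/8" "c * sqrt 6 = 3/2"
proof -
  show "c * sqrt 6 = 3/2" 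
    by (simp add: c_def flip: real_sqrt_mult) (simp add: real_sqrt_unique[of "3/2"] power2_eq_square)
qed (auto simp: c_def)

text \<open>The squares of the \<open>B y\<close> contribute 3 * 4 = 12 and the cross terms -2 c * 8
  sqrt 6 = -24, which leaves the constant -12.\<close>

lemma sum_tr_dist: "(\<Sum>y<3. tr ((B y - c *\<^sub>R W y) * (B y - c *\<^sub>R W y)))
    = 3/8 * (\<Sum>y<3. tr (W y * W y)) - 12"
proof -
  have "tr ((B y - c *\<^sub>R W y) * (B y - c *\<^sub>R W y)) = 4 - 2 * c * tr (B y * W y) + 3/8 * tr (W y * W y)"
    if "y < 3" for y
    using B(2)[OF that] tr_commute[of "B y" "W y"] c_props(1)
    by (simp add: algebra_simps tr_simps tr_one)
  then have "(\<Sum>y<3. tr ((B y - c *\<^sub>R W y) * (B y - c *\<^sub>R W y)))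
     = 12 - 2 * c * (\<Sum>y<3. tr (B y * W y)) + 3/8 * (\<Sum>y<3. tr (W y * W y))"
    by (simp add: sum.distrib sum_subtractf sum_distrib_left)
  moreover have "(\<Sum>y<3. tr (B y * W y)) = 8 * sqrt 6" using opt by (simp add: W_def D_def)
  ultimately show ?thesis using c_props(2) by simp
qed

lemma dist_H: "y < 3 \<Longrightarrow> B y - c *\<^sub>R W y \<in> H"
  by (intro subspace_diff[OF H_subspace] subspace_scale[OF H_subspace] B W_H)

text \<open>Let d, s, t be the three quantities in this order. Then the traces of the
  \<open>W y * W y\<close> sum to 32 - 4 s - t, so \<open>sum_tr_dist\<close> reads d + 3/2 s + 3/8
  t = 0 with all three nonnegative.\<close>

lemma tight:
  shows "(\<Sum>y<3. tr ((B y - c *\<^sub>R W y) * (B y - c *\<^sub>R W y))) = 0"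
    and "(\<Sum>i\<in>I. 2 - tr (D i * D i)) = 0"
    and "tr ((\<Sum>i\<in>I. D i) * (\<Sum>i\<in>I. D i)) = 0"
proof -
  have "0 \<le> (\<Sum>y<3. tr ((B y - c *\<^sub>R W y) * (B y - c *\<^sub>R W y)))"
    by (intro sum_nonneg tr_square_nonneg dist_H) auto
  moreover have "0 \<le> tr ((\<Sum>i\<in>I. D i) * (\<Sum>i\<in>I. D i))"
    by (intro tr_square_nonneg sum_D_H)
  moreover have "(\<Sum>i\<in>I. 2 - tr (D i * D i)) = 8 - (\<Sum>i\<in>I. tr (D i * D i))"
    using I by (simp add: sum_subtractf)
  ultimately show "(\<Sum>y<3. tr ((B y - c *\<^sub>R W y) * (B y - c *\<^sub>R W y))) = 0"
    "(\<Sum>i\<in>I. 2 - tr (D i * D i)) = 0" "tr ((\<Sum>i\<in>I. D i) * (\<Sum>i\<in>I. D i)) = 0"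
    using sum_tr_dist sum_tr_W_square sum_tr_D_square_le by linarith+
qed

lemma B_eq: "B y = c *\<^sub>R W y" if "y < 3"
proof -
  have "tr ((B y - c *\<^sub>R W y) * (B y - c *\<^sub>R W y)) = 0"
    using tight(1) that by (subst (asm) sum_nonneg_eq_0_iff) (auto intro: tr_square_nonneg dist_H)
  from tr_square_zero[OF dist_H[OF that] this] show ?thesis by simp
qed

lemma W_square: "W y * W y = (8/3) *\<^sub>R 1" if "y < 3"
proof -
  have "(3/8) *\<^sub>R (W y * W y) = 1"
    using B(2)[OF that] by (simp add: B_eq[OF that] c_props)
  then have "(8/3) *\<^sub>R ((3/8) *\<^sub>R (W y * W y)) = (8/3) *\<^sub>R 1" by simp
  then show ?thesis by simp
qed

text \<open>The value 2 of tr (D^2) is the extreme of \<open>tr_D_square\<close>: it forces both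
  purities up to 1 and the overlap down to 0.\<close>

lemma pure: assumes "i \<in> I"
  shows "tr (a i * a i) = 1" "tr (b i * b i) = 1" "tr (a i * b i) = 0"
proof -
  have "2 - tr (D i * D i) = 0"
    using tight(2) assms I tr_D_square_le by (subst (asm) sum_nonneg_eq_0_iff) auto
  then show "tr (a i * a i) = 1" "tr (b i * b i) = 1" "tr (a i * b i) = 0"
    using purity_le[of "a i"] purity_le[of "b i"] tr_pos[of "a i" "b i"] a b assms
    by (auto simp: tr_D_square)
qed

lemma idem: "i \<in> I \<Longrightarrow> a i * a i = a i" "i \<in> I \<Longrightarrow> b i * b i = b i"
  using pure_idem a b pure by auto

lemma D_square: "i \<in> I \<Longrightarrow> D i * D i = a i + b i"
  using tr_pos_zero[of "a i" "b i"] tr_pos_zero[of "b i" "a i"] a b pure[of i] tr_commute[of "a i" "b i"] idem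
  by (simp add: D_def algebra_simps)

lemma sum_eq: "(\<Sum>i\<in>I. a i) = 1" "(\<Sum>i\<in>I. b i) = 1"
proof -
  have *: "(\<Sum>i\<in>I. D i) = 0" using tr_square_zero[OF sum_D_H tight(3)] .
  then have eq: "(\<Sum>i\<in>I. a i) = (\<Sum>i\<in>I. b i)" by (simp add: D_def sum_subtractf)
  \<comment> \<open>Three squares equal to 8/3 add up to 8, and the subtracted square in
    \<open>sum_W_square\<close> is zero.\<close>
  have "8 *\<^sub>R 1 = 4 *\<^sub>R (\<Sum>i\<in>I. D i * D i)"
    using sum_W_square * W_square scaleR_sum_left[of "\<lambda>_. 8/3" "{..<3::nat}" "1 :: 'a"] by simp
  also have "\<dots> = 8 *\<^sub>R (\<Sum>i\<in>I. a i)"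
    using eq by (simp add: D_square sum.distrib flip: scaleR_2)
  finally show "(\<Sum>i\<in>I. a i) = 1" by simp
  with eq show "(\<Sum>i\<in>I. b i) = 1" by simp
qed

end

text \<open>Multiplying the resolution by p_i and taking the trace, the diagonal term alone already
  gives tr p_i; the other terms are nonnegative and sum to 0.\<close>

lemma (in tracial_algebra) resolution_orthogonal:
  assumes "finite I" "\<And>i. i \<in> I \<Longrightarrow> p i \<in> P" "\<And>i. i \<in> I \<Longrightarrow> p i * p i = p i"
    and "(\<Sum>i\<in>I. p i) = 1" "i \<in> I" "k \<in> I" "i \<noteq> k"
  shows "p i * p k = 0"
proof -
  have "tr (p i) = (\<Sum>j\<in>I. tr (p i * p j))"
    using assms(4) by (simp flip: tr_simps sum_distrib_left)
  also have "\<dots> = tr (p i) + (\<Sum>j\<in>I - {i}. tr (p i * p j))"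
    using assms by (simp add: sum.remove[of I i])
  finally have "(\<Sum>j\<in>I - {i}. tr (p i * p j)) = 0" by simp
  then have "tr (p i * p k) = 0"
    using assms by (subst (asm) sum_nonneg_eq_0_iff) (auto intro!: tr_pos)
  then show ?thesis using assms tr_pos_zero by auto
qed

section \<open>Orthogonality within a parity class and overlaps between the classes\<close>

context optimal_strategy begin

lemma orth: assumes "i \<in> I" "k \<in> I" "i \<noteq> k" shows "a i * a k = 0" "b i * b k = 0"
  using resolution_orthogonal[of I a i k] resolution_orthogonal[of I b i k] assms I a b idem sum_eq
  by auto

text \<open>\<open>W y\<close> is \<open>\<alpha> y - \<beta> y\<close>. Each part is a combination
  with signs of orthogonal projectors summing to 1, so its products are explicit.\<close>

definition \<alpha> where "\<alpha> y = (\<Sum>i\<in>I. h y i *\<^sub>R a i)"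
definition \<beta> where "\<beta> y = (\<Sum>i\<in>I. h y i *\<^sub>R b i)"

lemma a_\<alpha>: "j \<in> I \<Longrightarrow> a j * \<alpha> y = h y j *\<^sub>R a j" "j \<in> I \<Longrightarrow> \<alpha> y * a j = h y j *\<^sub>R a j"
proof -
  assume j: "j \<in> I"
  have "a j * \<alpha> y = (\<Sum>i\<in>I. if i = j then h y j *\<^sub>R a j else 0)"
    unfolding \<alpha>_def sum_distrib_left by (intro sum.cong refl) (auto simp: orth idem j)
  then show "a j * \<alpha> y = h y j *\<^sub>R a j" using j I by simp
  have "\<alpha> y * a j = (\<Sum>i\<in>I. if i = j then h y j *\<^sub>R a j else 0)"
    unfolding \<alpha>_def sum_distrib_right by (intro sum.cong refl) (auto simp: orth idem j)
  then show "\<alpha> y * a j = h y j *\<^sub>R a j" using j I by simp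
qed

lemma \<beta>_square: "\<beta> y * \<beta> y = 1" if "y < 3"
proof -
  have "\<beta> y * \<beta> y = (\<Sum>i\<in>I. \<Sum>k\<in>I. (h y i * h y k) *\<^sub>R (b i * b k))"
    by (simp add: \<beta>_def sum_product mult.commute)
  also have "\<dots> = (\<Sum>i\<in>I. \<Sum>k\<in>I. if k = i then b i else 0)"
    by (intro sum.cong refl) (auto simp: orth idem h_sq[OF that])
  finally show ?thesis using I sum_eq by simp
qed

text \<open>Two evaluations of tr (a_j W_y^2): it is 8/3 by \<open>W_square\<close>, while the
  expansion gives 1 from each square and -h tr (a_j \<beta>_y) from each cross term. Hence h tr (a_j
  \<beta>_y) = -1/3, with h = \<open>h y j\<close>.\<close>

lemma tr_a_\<beta>: assumes "y < 3" "j \<in> I" shows "tr (a j * \<beta> y) = - h y j / 3"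
proof -
  have W: "W y = \<alpha> y - \<beta> y" by (simp add: W_def \<alpha>_def \<beta>_def D_def scaleR_diff_right sum_subtractf)
  have "8/3 = tr (a j * (W y * W y))" using assms a by (simp add: W_square tr_simps)
  also have "a j * (W y * W y) = (a j * \<alpha> y) * \<alpha> y - (a j * \<alpha> y) * \<beta> y - a j * \<beta> y * \<alpha> y + a j * (\<beta> y * \<beta> y)"
    by (simp add: W algebra_simps)
  also have "tr \<dots> = 2 - h y j * tr (a j * \<beta> y) - tr (a j * \<beta> y * \<alpha> y)"
    using assms by (simp add: a_\<alpha> \<beta>_square h_sq tr_simps a)
  also have "tr (a j * \<beta> y * \<alpha> y) = h y j * tr (a j * \<beta> y)"
    using tr_commute[of "a j * \<beta> y" "\<alpha> y"] assms by (simp flip: mult.assoc add: a_\<alpha> tr_simps)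
  finally have "h y j * tr (a j * \<beta> y) = -1/3" by simp
  then have "h y j * (h y j * tr (a j * \<beta> y)) = - h y j / 3" by simp
  then show ?thesis using h_sq[OF assms] by (simp flip: mult.assoc)
qed

text \<open>The signs invert the transform from b to \<beta>: weighting \<open>tr_a_\<beta>\<close>
  by \<open>h y k\<close> and summing over y gives 4 tr (a_j b_k) - 1 on one side and 1/3 on the
  other.\<close>

lemma tr_a_b: assumes "j \<in> I" "k \<in> I" "j \<noteq> k" shows "tr (a j * b k) = 1/3"
proof -
  have one: "(\<Sum>i\<in>I. tr (a j * b i)) = 1"
    using sum_eq a assms by (simp flip: tr_simps sum_distrib_left)
  have "(\<Sum>y<3. h y k * tr (a j * \<beta> y)) = (\<Sum>y<3. \<Sum>i\<in>I. h y i * h y k * tr (a j * b i))"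
    by (simp add: \<beta>_def sum_distrib_left tr_simps mult_ac)
  also have "\<dots> = (\<Sum>i\<in>I. (\<Sum>y<3. h y i * h y k) * tr (a j * b i))"
    by (subst sum.swap) (simp add: sum_distrib_right)
  also have "\<dots> = (\<Sum>i\<in>I. (if i = k then 4 * tr (a j * b i) else 0) - tr (a j * b i))"
    by (intro sum.cong refl) (auto simp: h_orth assms)
  also have "\<dots> = 4 * tr (a j * b k) - 1"
    using I assms one by (simp add: sum_subtractf)
  finally have "4 * tr (a j * b k) - 1 = (\<Sum>y<3. h y k * (- h y j / 3))"
    using assms by (simp add: tr_a_\<beta>)
  also have "\<dots> = - (\<Sum>y<3. h y k * h y j) / 3"
    by (simp add: sum_negf sum_divide_distrib)
  finally show ?thesis using h_orth[of k j] assms by simp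
qed

end

subsection \<open>The algebra of two-qubit operators\<close>

text \<open>The operations of the matrix library obey the ring laws only on a carrier; a type of their own gives
  the 4 by 4 matrices the class structure that the abstract argument needs.\<close>

typedef cmat4 = "carrier_mat 4 4 :: complex mat set"
  by (rule exI[of _ "0\<^sub>m 4 4"]) simp

setup_lifting type_definition_cmat4

instantiation cmat4 :: real_algebra_1
begin

lift_definition zero_cmat4 :: cmat4 is "0\<^sub>m 4 4" by simp
lift_definition one_cmat4 :: cmat4 is "1\<^sub>m 4" by simp
lift_definition plus_cmat4 :: "cmat4 \<Rightarrow> cmat4 \<Rightarrow> cmat4" is "(+)" by simp
lift_definition minus_cmat4 :: "cmat4 \<Rightarrow> cmat4 \<Rightarrow> cmat4" is "(-)" by (simp add: minus_carrier_mat)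
lift_definition uminus_cmat4 :: "cmat4 \<Rightarrow> cmat4" is "uminus" by simp
lift_definition times_cmat4 :: "cmat4 \<Rightarrow> cmat4 \<Rightarrow> cmat4" is "(*)" by simp
lift_definition scaleR_cmat4 :: "real \<Rightarrow> cmat4 \<Rightarrow> cmat4" is "\<lambda>c A. of_real c \<cdot>\<^sub>m A" by simp

instance
proof
  fix x y z :: cmat4 and r s :: real
  show "x + y + z = x + (y + z)" by transfer simp
  show "x + y = y + x" by transfer (rule comm_add_mat)
  show "0 + x = x" by transfer simp
  show "- x + x = 0" by transfer simp
  show "x - y = x + - y" by transfer (simp add: minus_add_uminus_mat)
  show "x * y * z = x * (y * z)" by transfer simp
  show "1 * x = x" by transfer simp
  show "x * 1 = x" by transfer simp
  show "(x + y) * z = x * z + y * z" by transfer (rule add_mult_distrib_mat)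
  show "x * (y + z) = x * y + x * z" by transfer (rule mult_add_distrib_mat)
  show "(0 :: cmat4) \<noteq> 1"
  proof transfer
    have "0\<^sub>m 4 4 $$ (0,0) \<noteq> (1\<^sub>m 4 $$ (0,0) :: complex)" by simp
    then show "0\<^sub>m 4 4 \<noteq> (1\<^sub>m 4 :: complex mat)" by metis
  qed
  show "r *\<^sub>R (x + y) = r *\<^sub>R x + r *\<^sub>R y" by transfer (rule add_smult_distrib_left_mat)
  show "(r + s) *\<^sub>R x = r *\<^sub>R x + s *\<^sub>R x" by transfer (simp add: add_smult_distrib_right_mat)
  show "r *\<^sub>R s *\<^sub>R x = (r * s) *\<^sub>R x" by transfer (auto intro!: eq_matI)
  show "1 *\<^sub>R x = x" by transfer (auto intro!: eq_matI)
  show "(r *\<^sub>R x) * y = r *\<^sub>R (x * y)" by transfer (rule mult_smult_assoc_mat)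
  show "x * (r *\<^sub>R y) = r *\<^sub>R (x * y)" by transfer (rule mult_smult_distrib)
qed

end

lift_definition tr4 :: "cmat4 \<Rightarrow> real" is "\<lambda>A. Re (mtrace A)" .
lift_definition herm4 :: "cmat4 set" is "{A \<in> carrier_mat 4 4. hermitian A}" by auto
lift_definition psd4 :: "cmat4 set" is "{A. psd 4 A}" by (auto simp: psd_def)

lemma hermitian_closed:
  assumes "A \<in> carrier_mat n n" "B \<in> carrier_mat n n" "hermitian A" "hermitian B"
  shows "hermitian (A + B)" "hermitian (of_real r \<cdot>\<^sub>m A)" 
  using assms hermitian_iff[OF assms(1)] hermitian_iff[OF assms(2)] hermitian_iff[of "A + B" n]
    hermitian_iff[of "of_real r \<cdot>\<^sub>m A" n]
  by auto

interpretation m4: tracial_algebra tr4 herm4 psd4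
proof
  fix x y :: cmat4 and r :: real
  show "tr4 (x + y) = tr4 x + tr4 y" by transfer (auto simp: mtrace_def sum.distrib)
  show "tr4 (r *\<^sub>R x) = r *\<^sub>R tr4 x" by transfer (auto simp: mtrace_def sum_distrib_left)
  show "tr4 (x * y) = tr4 (y * x)" by transfer (simp add: mtrace_mult_commute)
  show "subspace herm4"
  proof (rule subspaceI)
    show "0 \<in> herm4" by transfer (simp add: hermitian_iff[of _ 4])
  next
    fix x y assume "x \<in> herm4" "y \<in> herm4"
    then show "x + y \<in> herm4" by transfer (simp add: hermitian_closed)
  next
    fix x r assume "x \<in> herm4"
    then show "r *\<^sub>R x \<in> herm4" by transfer (simp add: hermitian_closed)
  qed
  show "psd4 \<subseteq> herm4" by transfer (auto simp: psd_def)
  show "0 \<le> tr4 (x * x)" if "x \<in> herm4"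
    using that by transfer (simp add: mtrace_hermitian_square sum_nonneg)
  show "x = 0" if "x \<in> herm4" "tr4 (x * x) = 0"
    using that
  proof transfer
    fix A :: "complex mat"
    assume "A \<in> {A \<in> carrier_mat 4 4. hermitian A}" and tr: "Re (mtrace (A * A)) = 0"
    then have A: "A \<in> carrier_mat 4 4" "hermitian A" by auto
    have "(\<Sum>i<4. \<Sum>k<4. (cmod (A $$ (i,k)))\<^sup>2) = 0" using tr mtrace_hermitian_square[OF A] by simp
    then have "A $$ (i,k) = 0" if "i < 4" "k < 4" for i k
      using that by (simp add: sum_nonneg_eq_0_iff sum_nonneg)
    then show "A = 0\<^sub>m 4 4" using A by (intro eq_matI) auto
  qed
  show "0 \<le> tr4 (x * y)" if "x \<in> psd4" "y \<in> psd4"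
    using that by transfer (simp add: mtrace_psd_mult_nonneg)
  show "x * y = 0" if "x \<in> psd4" "y \<in> psd4" "tr4 (x * y) = 0"
    using that
  proof transfer
    fix A C :: "complex mat"
    assume "A \<in> {A. psd 4 A}" "C \<in> {A. psd 4 A}" and tr: "Re (mtrace (A * C)) = 0"
    then have psd: "psd 4 A" "psd 4 C" by auto
    \<comment> \<open>\<open>psd_mult_zero\<close> yields the product in reverse order, so the trace
      is commuted first.\<close>
    have "Re (mtrace (C * A)) = 0" using tr mtrace_mult_commute[of A 4 4 C] psd psd_carrier by simp
    with psd show "A * C = 0\<^sub>m 4 4" by (intro psd_mult_zero)
  qed
  show "1 - x \<in> psd4" if "x \<in> psd4" "tr4 x = 1"
    using that
  proof transfer
    fix A assume "A \<in> {A. psd 4 A}" "Re (mtrace A) = 1"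
    \<comment> \<open>\<open>tr4\<close> sees only the real part; Hermiticity, via the product with
      the identity, makes the trace itself 1.\<close>
    moreover from this have "mtrace A = 1"
      using mtrace_hermitian_mult[of A 4 "1\<^sub>m 4"] psd_carrier[of 4 A] psd_hermitian[of 4 A]
      by (simp add: hermitian_iff[of "1\<^sub>m 4" 4])
    ultimately show "1\<^sub>m 4 - A \<in> {A. psd 4 A}" using psd_one_minus by simp
  qed
qed

lemma mem_herm4: "x \<in> herm4 \<longleftrightarrow> hermitian (Rep_cmat4 x)"
  by transfer simp

lemma mem_psd4: "x \<in> psd4 \<longleftrightarrow> psd 4 (Rep_cmat4 x)"
  by transfer simp

lemma tr4_one: "tr4 1 = 4" by transfer (simp add: mtrace_def)

subsection \<open>The random access code\<close>

text \<open>One representative of each complementary pair, since flipping three bits changes the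
  parity.\<close>

definition even3 :: "nat list set" where "even3 = {x \<in> bits3. parity3 x = 0}"

lemma bits3_eq: "bits3 = {[0,0,0],[0,0,1],[0,1,0],[0,1,1],[1,0,0],[1,0,1],[1,1,0],[1,1,1]}"
proof (rule subset_antisym[OF subsetI])
  fix x assume x: "x \<in> bits3"
  then obtain p q r where eq: "x = [p,q,r]"
    by (auto simp: bits3_def numeral_3_eq_3 length_Suc_conv)
  have "x ! 0 \<le> 1" "x ! 1 \<le> 1" "x ! 2 \<le> 1" using x by (auto simp: bits3_def)
  then have "p = 0 \<or> p = 1" "q = 0 \<or> q = 1" "r = 0 \<or> r = 1" by (auto simp: eq)
  then show "x \<in> {[0,0,0],[0,0,1],[0,1,0],[0,1,1],[1,0,0],[1,0,1],[1,1,0],[1,1,1]}"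
    unfolding eq by (elim disjE) simp_all
next
  show "{[0,0,0],[0,0,1],[0,1,0],[0,1,1],[1,0,0],[1,0,1],[1,1,0],[1,1,1]} \<subseteq> bits3"
    by (simp add: bits3_def numeral_3_eq_3 All_less_Suc)
qed

lemma even3_eq: "even3 = {[0,0,0],[0,1,1],[1,0,1],[1,1,0]}"
  by (auto simp: even3_def bits3_eq parity3_def)

lemma compl3_compl3: "x \<in> bits3 \<Longrightarrow> compl3 (compl3 x) = x"
  unfolding bits3_eq by (auto simp: compl3_def)

lemma compl3_bits3: "x \<in> bits3 \<Longrightarrow> compl3 x \<in> bits3"
  unfolding bits3_eq by (auto simp: compl3_def)

lemma compl3_even3: "x \<in> bits3 \<Longrightarrow> compl3 x \<in> even3 \<longleftrightarrow> x \<notin> even3"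
  unfolding bits3_eq even3_eq by (auto simp: compl3_def)

lemma parity3_eq_iff:
  assumes "x \<in> bits3" "x' \<in> bits3"
  shows "parity3 x = parity3 x' \<longleftrightarrow> (x \<in> even3 \<longleftrightarrow> x' \<in> even3)"
proof -
  have "parity3 x < 2" "parity3 x' < 2" by (simp_all add: parity3_def)
  then show ?thesis using assms by (auto simp: even3_def less_2_cases_iff)
qed

lemma sum_three: "(\<Sum>y<3. f y) = f 0 + f 1 + f (2::nat)"
  by (simp add: numeral_3_eq_3 numeral_2_eq_2)

text \<open>Distinct even strings differ in exactly two bits: the sign vectors are the vertices of a
  regular tetrahedron inscribed in the cube.\<close>

lemma sign_orth: "i \<in> even3 \<Longrightarrow> k \<in> even3 \<Longrightarrow>
   (\<Sum>y<3. (1 - 2 * real (i ! y)) * (1 - 2 * real (k ! y))) = (if i = k then 3 else -1)"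
  by (auto simp: even3_eq sum_three)

section \<open>States and observables of a strategy\<close>

lemma rhox_density:
  assumes "density 4 \<rho>" "cptp_qubit (L x)"
  shows "density 4 (rhox L \<rho> x)"
proof -
  \<comment> \<open>The dimension is kept as \<open>2*2\<close> to match complete positivity with n
    = 2.\<close>
  have \<rho>: "psd (2*2) \<rho>" "mtrace \<rho> = 1" using assms(1) by (auto simp: density_def)
  have "\<forall>n>0. \<forall>X. psd (2*n) X \<longrightarrow> psd (2*n) (ext_first (L x) n X)"
    using assms(2) unfolding cptp_qubit_def by (elim conjE)
  from this[rule_format, OF zero_less_numeral \<rho>(1)]
  have "psd (2*2) (rhox L \<rho> x)" unfolding rhox_def .
  moreover have "mtrace (rhox L \<rho> x) = 1"
    using mtrace_ext_first[OF assms(2), of 2 \<rho>] psd_carrier[OF \<rho>(1)] \<rho>(2) by (simp add: rhox_def)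
  ultimately show ?thesis by (simp add: density_def)
qed

lemma observable_props:
  assumes "proj_meas2 n P Q"
  shows "P - Q \<in> carrier_mat n n" "hermitian (P - Q)" "(P - Q) * (P - Q) = 1\<^sub>m n"
    and "P = (1/2) \<cdot>\<^sub>m (1\<^sub>m n + (P - Q))" "Q = (1/2) \<cdot>\<^sub>m (1\<^sub>m n - (P - Q))"
proof -
  have P: "P \<in> carrier_mat n n" "hermitian P" "P * P = P"
    and Q: "Q \<in> carrier_mat n n" "hermitian Q" "Q * Q = Q" and PQ: "P + Q = 1\<^sub>m n"
    using assms by (auto simp: proj_meas2_def projector_def)
  show "P - Q \<in> carrier_mat n n" "hermitian (P - Q)"
    using P Q by (auto intro: minus_carrier_mat hermitian_minus)
  show "P = (1/2) \<cdot>\<^sub>m (1\<^sub>m n + (P - Q))" "Q = (1/2) \<cdot>\<^sub>m (1\<^sub>m n - (P - Q))"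
    unfolding PQ[symmetric] using P(1) Q(1) by (auto intro!: eq_matI)
  \<comment> \<open>Multiplying the completeness relation by P on either side shows that the two
    projectors annihilate each other.\<close>
  have "P * (P + Q) = P" "(P + Q) * P = P" using P PQ by auto
  then have "P + P * Q = P" "P + Q * P = P"
    using P Q mult_add_distrib_mat[of P n n P n Q] add_mult_distrib_mat[of P n n Q P n] by auto
  have "P * Q = (P + P * Q) - P" "Q * P = (P + Q * P) - P"
    using P Q by (auto intro!: eq_matI)
  then have PQ0: "P * Q = 0\<^sub>m n n" "Q * P = 0\<^sub>m n n"
    using \<open>P + P * Q = P\<close> \<open>P + Q * P = P\<close> P(1) by auto
  have "(P - Q) * (P - Q) = P * P - Q * P - (P * Q - Q * Q)"
    using P(1) Q(1) minus_carrier_mat[of Q n n P]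
    by (simp add: minus_mult_distrib_mat[of P n n Q _ n] mult_minus_distrib_mat[of _ n n P n Q])
  also have "\<dots> = P + Q" using P Q by (auto intro!: eq_matI simp: PQ0)
  finally show "(P - Q) * (P - Q) = 1\<^sub>m n" by (simp add: PQ)
qed

theorem theorem1:
  fixes \<rho> :: "complex mat"
    and L :: "nat list \<Rightarrow> complex mat \<Rightarrow> complex mat"
    and Pm :: "nat \<Rightarrow> nat \<Rightarrow> complex mat"
  assumes state: "density 4 \<rho>"
    and chans: "\<forall>x \<in> bits3. cptp_qubit (L x)"
    and meas: "\<forall>y \<in> {1,2,3}. proj_meas2 4 (Pm y 0) (Pm y 1)"
    and opt: "succ_prob L \<rho> Pm = 1/2 + 1 / sqrt 6"
  shows
    "(\<forall>x \<in> bits3. \<forall>x' \<in> bits3. parity3 x = parity3 x' \<and> x \<noteq> x' \<longrightarrow>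
        rhox L \<rho> x * rhox L \<rho> x' = 0\<^sub>m 4 4) \<and>
     rhox L \<rho> [0,0,0] + rhox L \<rho> [0,1,1] + rhox L \<rho> [1,0,1] + rhox L \<rho> [1,1,0] = 1\<^sub>m 4 \<and>
     rhox L \<rho> [0,0,1] + rhox L \<rho> [0,1,0] + rhox L \<rho> [1,0,0] + rhox L \<rho> [1,1,1] = 1\<^sub>m 4 \<and>
     (\<forall>x \<in> bits3. mtrace (rhox L \<rho> x * rhox L \<rho> (compl3 x)) = 0) \<and>
     (\<forall>x \<in> bits3. \<forall>x' \<in> bits3. parity3 x \<noteq> parity3 x' \<and> x' \<noteq> compl3 x \<longrightarrow>
        mtrace (rhox L \<rho> x * rhox L \<rho> x') = 1/3) \<and>
     (\<forall>y \<in> {1,2,3}. Pm y 0 - Pm y 1 =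
        complex_of_real (sqrt (3/8)) \<cdot>\<^sub>m (Nop (rhox L \<rho>) y - Mop (rhox L \<rho>) y))"
proof -
  define r where "r x = Abs_cmat4 (rhox L \<rho> x)" for x
  \<comment> \<open>\<open>B y\<close> is the observable of question y + 1, matching the list index
    in \<open>x ! y\<close>.\<close>
  define B where "B y = Abs_cmat4 (Pm (Suc y) 0 - Pm (Suc y) 1)" for y
  define h where "h y x = 1 - 2 * real (x ! y)" for y :: nat and x :: "nat list"
  have dens: "density 4 (rhox L \<rho> x)" if "x \<in> bits3" for x
    using rhox_density state chans that by blast
  have r_Rep: "Rep_cmat4 (r x) = rhox L \<rho> x" if "x \<in> bits3" for x
    unfolding r_def using dens[OF that] by (intro Abs_cmat4_inverse) (auto simp: density_def psd_def)
  have r_psd: "r x \<in> psd4" and r_tr: "tr4 (r x) = 1" if "x \<in> bits3" for x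
    using dens[OF that] r_Rep[OF that] by (auto simp: mem_psd4 density_def tr4.rep_eq)
  have obs: "proj_meas2 4 (Pm (Suc y) 0) (Pm (Suc y) 1)" if "y < 3" for y
    using meas that by (auto simp: less_Suc_eq numeral_3_eq_3 numeral_2_eq_2)
  have B_Rep: "Rep_cmat4 (B y) = Pm (Suc y) 0 - Pm (Suc y) 1" if "y < 3" for y
    unfolding B_def using observable_props(1)[OF obs[OF that]] by (intro Abs_cmat4_inverse)
  have B_H: "B y \<in> herm4" and B_sq: "B y * B y = 1" if "y < 3" for y
    using observable_props(2,3)[OF obs[OF that]] B_Rep[OF that]
    by (simp_all add: mem_herm4 Rep_cmat4_inject[symmetric] times_cmat4.rep_eq one_cmat4.rep_eq)
  have even_bits: "x \<in> bits3" "compl3 x \<in> bits3" if "x \<in> even3" for x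
    using that by (auto simp: even3_eq bits3_eq compl3_def)
  have P_Rep: "Pm (Suc y) 0 = Rep_cmat4 ((1/2) *\<^sub>R (1 + B y))" "Pm (Suc y) 1 = Rep_cmat4 ((1/2) *\<^sub>R (1 - B y))"
    if "y < 3" for y
    using observable_props(4,5)[OF obs[OF that]] B_Rep[OF that]
    by (simp_all add: scaleR_cmat4.rep_eq plus_cmat4.rep_eq minus_cmat4.rep_eq one_cmat4.rep_eq)
  \<comment> \<open>Each projector is half of the identity plus or minus the observable, and
    \<open>h y x\<close> is the sign selected by the bit.\<close>
  have prob: "Re (mtrace (rhox L \<rho> x * Pm (Suc y) (x ! y))) = (1 + h y x * tr4 (r x * B y)) / 2"
    if "x \<in> bits3" "y < 3" for x y
  proof -
    have "x ! y \<le> 1" using that by (auto simp: bits3_def)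
    then consider "x ! y = 0" | "x ! y = 1" by linarith
    then show ?thesis
    proof cases
      case 1
      have "Re (mtrace (rhox L \<rho> x * Pm (Suc y) 0)) = tr4 (r x * ((1/2) *\<^sub>R (1 + B y)))"
        by (simp only: P_Rep(1)[OF that(2)] tr4.rep_eq times_cmat4.rep_eq r_Rep[OF that(1)])
      then show ?thesis using 1 r_tr[OF that(1)] by (simp add: h_def m4.tr_simps distrib_left)
    next
      case 2
      have "Re (mtrace (rhox L \<rho> x * Pm (Suc y) 1)) = tr4 (r x * ((1/2) *\<^sub>R (1 - B y)))"
        by (simp only: P_Rep(2)[OF that(2)] tr4.rep_eq times_cmat4.rep_eq r_Rep[OF that(1)])
      then show ?thesis using 2 r_tr[OF that(1)] by (simp add: h_def m4.tr_simps right_diff_distrib)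
    qed
  qed
  have split: "(\<Sum>x\<in>bits3. f x) = (\<Sum>x\<in>even3. f x + f (compl3 x))" for f :: "nat list \<Rightarrow> real"
    by (simp add: bits3_eq even3_eq compl3_def)
  have h_compl: "h y (compl3 x) = - h y x" if "x \<in> even3" "y < 3" for x y
    using that by (auto simp: h_def even3_eq compl3_def less_Suc_eq numeral_3_eq_3)
  \<comment> \<open>The success probability is 1/24 * (12 + T/2) = 1/2 + T/48 for the left-hand side
    T, so the optimal value means T = 48 / sqrt 6.\<close>
  have total: "(\<Sum>y<3. tr4 (B y * (\<Sum>x\<in>even3. h y x *\<^sub>R (r x - r (compl3 x))))) = 8 * sqrt 6" (is "?T = _")
  proof -
    have row: "(\<Sum>x\<in>bits3. Re (mtrace (rhox L \<rho> x * Pm (Suc y) (x ! y))))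
        = 4 + tr4 (B y * (\<Sum>x\<in>even3. h y x *\<^sub>R (r x - r (compl3 x)))) / 2" if "y < 3" for y
    proof -
      have "(\<Sum>x\<in>bits3. Re (mtrace (rhox L \<rho> x * Pm (Suc y) (x ! y))))
        = (\<Sum>x\<in>even3. 1 + h y x * (tr4 (B y * r x) - tr4 (B y * r (compl3 x))) / 2)"
        unfolding split using that even_bits
        by (intro sum.cong refl)
          (simp add: prob h_compl m4.tr_commute[of _ "B y"] diff_divide_distrib add_divide_distrib right_diff_distrib)
      \<comment> \<open>Each of the four complementary pairs contributes the constant 1/2 +
        1/2.\<close>
      also have "\<dots> = 4 + (\<Sum>x\<in>even3. h y x * (tr4 (B y * r x) - tr4 (B y * r (compl3 x)))) / 2"
        by (simp add: sum.distrib even3_eq sum_divide_distrib)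
      finally show ?thesis by (simp add: sum_distrib_left m4.tr_simps right_diff_distrib)
    qed
    have "succ_prob L \<rho> Pm = 1/24 * (\<Sum>y<3. \<Sum>x\<in>bits3. Re (mtrace (rhox L \<rho> x * Pm (Suc y) (x ! y))))"
      by (simp add: succ_prob_def sum_three numeral_2_eq_2 numeral_3_eq_3 add.assoc)
    also have "\<dots> = 1/2 + ?T / 48"
      by (simp add: row sum.distrib flip: sum_divide_distrib)
    finally have "?T = 48 / sqrt 6" using opt by simp
    also have "\<dots> = 8 * sqrt 6" by (simp add: field_simps)
    finally show ?thesis .
  qed
  interpret optimal_strategy tr4 herm4 psd4 even3 r "\<lambda>x. r (compl3 x)" h B
  proof
    show "tr4 1 = 4" by (rule tr4_one)
    show "finite even3" "card even3 = 4" by (auto simp: even3_eq)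
    show "r i \<in> psd4" "tr4 (r i) = 1" "r (compl3 i) \<in> psd4" "tr4 (r (compl3 i)) = 1" if "i \<in> even3" for i
      using r_psd r_tr even_bits[OF that] by auto
    show "h y i * h y i = 1" if "y < 3" "i \<in> even3" for y i
      using that by (auto simp: h_def even3_eq less_Suc_eq numeral_3_eq_3)
    show "(\<Sum>y<3. h y i * h y k) = (if i = k then 3 else -1)" if "i \<in> even3" "k \<in> even3" for i k
      using sign_orth[OF that] by (simp add: h_def)
    show "B y \<in> herm4" "B y * B y = 1" if "y < 3" for y
      using that by (fact B_H, fact B_sq)
    show "(\<Sum>y<3. tr4 (B y * (\<Sum>i\<in>even3. h y i *\<^sub>R (r i - r (compl3 i))))) = 8 * sqrt 6"
      by (rule total)
  qed
  have Rep: "rhox L \<rho> x = Rep_cmat4 (r x)" if "x \<in> bits3" for x using r_Rep[OF that] by simp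
  have tr_Rep: "mtrace (rhox L \<rho> x * rhox L \<rho> x') = of_real (tr4 (r x * r x'))" if "x \<in> bits3" "x' \<in> bits3" for x x'
    using dens[OF that(1)] dens[OF that(2)] mtrace_hermitian_mult[of "rhox L \<rho> x" 4 "rhox L \<rho> x'"] that
    by (simp add: density_def psd_def tr4.rep_eq times_cmat4.rep_eq r_Rep)
  have orth_all: "r x * r x' = 0"
    if x: "x \<in> bits3" "x' \<in> bits3" and par: "parity3 x = parity3 x'" and neq: "x \<noteq> x'" for x x'
  proof (cases "x \<in> even3")
    case True
    then show ?thesis using orth(1) par neq parity3_eq_iff[OF x] by simp
  next
    case False
    \<comment> \<open>Odd strings are reached as complements of even ones, so the family b
      applies.\<close>
    then have "compl3 x \<in> even3" "compl3 x' \<in> even3"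
      using par x by (simp_all add: compl3_even3 parity3_eq_iff)
    moreover have "compl3 x \<noteq> compl3 x'" using neq x compl3_compl3 by metis
    ultimately show ?thesis using orth(2)[of "compl3 x" "compl3 x'"] x by (simp add: compl3_compl3)
  qed
  have compl_zero: "tr4 (r x * r (compl3 x)) = 0" if x: "x \<in> bits3" for x
  proof (cases "x \<in> even3")
    case True then show ?thesis by (rule pure)
  next
    case False
    then have "compl3 x \<in> even3" using x by (simp add: compl3_even3)
    from pure(3)[OF this] show ?thesis
      using m4.tr_commute[of "r x" "r (compl3 x)"] x by (simp add: compl3_compl3)
  qed
  have third: "tr4 (r x * r x') = 1/3"
    if x: "x \<in> bits3" "x' \<in> bits3" and par: "parity3 x \<noteq> parity3 x'" and neq: "x' \<noteq> compl3 x" for x x'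
  proof (cases "x \<in> even3")
    case True
    then have "compl3 x' \<in> even3" using par x by (simp add: compl3_even3 parity3_eq_iff)
    moreover have "x \<noteq> compl3 x'" using neq x compl3_compl3 by metis
    ultimately show ?thesis using tr_a_b[of x "compl3 x'"] True x by (simp add: compl3_compl3)
  next
    case False
    \<comment> \<open>Now x' is the even string; the symmetry of the trace exchanges the two
      roles.\<close>
    then have "x' \<in> even3" "compl3 x \<in> even3" using par x by (simp_all add: compl3_even3 parity3_eq_iff)
    then show ?thesis using tr_a_b[of x' "compl3 x"] neq m4.tr_commute[of "r x" "r x'"] x
      by (simp add: compl3_compl3)
  qed
  \<comment> \<open>The even states in \<open>W y\<close> assemble to -M and their complements,
    which carry the opposite sign, to N.\<close>
  have Rep_W: "Rep_cmat4 (W y) = Nop (rhox L \<rho>) (Suc y) - Mop (rhox L \<rho>) (Suc y)" if "y < 3" for y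
  proof -
    consider "y = 0" | "y = 1" | "y = 2" using \<open>y < 3\<close> by linarith
    then show ?thesis
    proof cases
      case 1
      have W: "W 0 = (r [0,0,1] + r [0,1,0] - r [1,0,0] - r [1,1,1])
          - (- r [0,0,0] - r [0,1,1] + r [1,0,1] + r [1,1,0])"
        unfolding W_def unfolding D_def even3_eq by (simp add: h_def compl3_def)
      show ?thesis unfolding 1 W plus_cmat4.rep_eq minus_cmat4.rep_eq uminus_cmat4.rep_eq
        by (simp add: Nop_def Mop_def Rep bits3_eq)
    next
      case 2
      have W: "W (Suc 0) = (r [0,0,1] - r [0,1,0] + r [1,0,0] - r [1,1,1])
          - (- r [0,0,0] + r [0,1,1] - r [1,0,1] + r [1,1,0])"
        unfolding W_def unfolding D_def even3_eq by (simp add: h_def compl3_def)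
      show ?thesis unfolding 2 One_nat_def W plus_cmat4.rep_eq minus_cmat4.rep_eq uminus_cmat4.rep_eq
        by (simp add: Nop_def Mop_def Rep bits3_eq)
    next
      case 3
      have W: "W 2 = (- r [0,0,1] + r [0,1,0] + r [1,0,0] - r [1,1,1])
          - (- r [0,0,0] + r [0,1,1] + r [1,0,1] - r [1,1,0])"
        unfolding W_def unfolding D_def even3_eq by (simp add: h_def compl3_def)
      show ?thesis unfolding 3 W plus_cmat4.rep_eq minus_cmat4.rep_eq uminus_cmat4.rep_eq
        by (simp add: Nop_def Mop_def Rep bits3_eq)
    qed
  qed
  have obs_eq: "Pm y 0 - Pm y 1 = of_real (sqrt (3/8)) \<cdot>\<^sub>m (Nop (rhox L \<rho>) y - Mop (rhox L \<rho>) y)"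
    if "y \<in> {1,2,3}" for y
  proof -
    have y: "y - 1 < 3" "Suc (y - 1) = y" using that by auto
    have "Rep_cmat4 (B (y - 1)) = of_real c \<cdot>\<^sub>m Rep_cmat4 (W (y - 1))"
      by (simp only: B_eq[OF y(1)] scaleR_cmat4.rep_eq)
    then show ?thesis unfolding B_Rep[OF y(1)] Rep_W[OF y(1)] y(2) c_def .
  qed
  have sums: "r [0,0,0] + r [0,1,1] + r [1,0,1] + r [1,1,0] = 1"
    "r [0,0,1] + r [0,1,0] + r [1,0,0] + r [1,1,1] = 1"
    using sum_eq by (simp_all add: even3_eq compl3_def algebra_simps)
  have "rhox L \<rho> [0,0,0] + rhox L \<rho> [0,1,1] + rhox L \<rho> [1,0,1] + rhox L \<rho> [1,1,0] = 1\<^sub>m 4"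
    "rhox L \<rho> [0,0,1] + rhox L \<rho> [0,1,0] + rhox L \<rho> [1,0,0] + rhox L \<rho> [1,1,1] = 1\<^sub>m 4"
    using sums by (simp_all add: Rep bits3_eq flip: plus_cmat4.rep_eq one_cmat4.rep_eq)
  moreover have "rhox L \<rho> x * rhox L \<rho> x' = 0\<^sub>m 4 4"
    if "x \<in> bits3" "x' \<in> bits3" "parity3 x = parity3 x'" "x \<noteq> x'" for x x'
    using orth_all[OF that] that by (simp add: Rep flip: times_cmat4.rep_eq zero_cmat4.rep_eq)
  moreover have "mtrace (rhox L \<rho> x * rhox L \<rho> (compl3 x)) = 0" if "x \<in> bits3" for x
    using compl_zero[OF that] that by (simp add: tr_Rep compl3_bits3)
  moreover have "mtrace (rhox L \<rho> x * rhox L \<rho> x') = 1/3"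
    if "x \<in> bits3" "x' \<in> bits3" "parity3 x \<noteq> parity3 x'" "x' \<noteq> compl3 x" for x x'
    using that by (simp add: tr_Rep third)
  ultimately show ?thesis using obs_eq by blast
qed

end
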